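(* Let $A$ be an MV-algebra and let $I$ be a proper ideal of $A$. Then $\mathrm{diam}(\Gamma_I(A))=3$ if and only if $\mathrm{diam}(\Gamma(A/I))=3$.
   Context: An MV-algebra is an algebra $(A,\oplus,*,0)$ of type $(2,1,0)$ such that $(A,\oplus,0)$ is a commutative monoid, $x^{**}=x$, $x\oplus 0^*=0^*$, and $(x^*\oplus y)^*\oplus y=(y^*\oplus x)^*\oplus x$ for all $x,y$. Put $1=0^*$, $x\odot y=(x^*\oplus y^* )^*$, and $x\le y$ iff $x^*\oplus y=1$ (a partial order). An ideal of $A$ is a subset $I\subseteq A$ with $0\in I$; $a,b\in I$ implies $a\oplus b\in I$; and $b\in I$, $a\le b$ implies $a\in I$. It is proper if $I\ne A$. With $d(x,y)=(x\odot y^* )\oplus(y\odot x^* )$, the relation $x\equiv_I y\iff d(x,y)\in I$ is a congruence and $A/I$ is the corresponding quotient MV-algebra. For a proper ideal $I$, $\Gamma_I(A)$ is the simple graph with vertex set $\{x\in A\setminus I : \exists y\in A\setminus I,\ x\odot y\in I\}$, in which distinct vertices $x,y$ are adjacent iff $x\odot y\in I$. For a nontrivial MV-algebra $B$ (at least two elements), the zero-divisor graph is $\Gamma(B)=\Gamma_{\{0\}}(B)$. The diameter of a graph is the supremum (in $[0,\infty]$) of the distances (lengths of shortest paths) between pairs of vertices. *)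

theory Defs
  imports
    "HOL-Algebra.Congruence"
    "HOL-Library.Extended_Nat"
    "Graph_Theory.Pair_Digraph"
    "Graph_Theory.Vertex_Walk"
begin

no_notation vwalk_join (infixr \<open>\<oplus>\<close> 65)

section \<open>MV-algebras\<close>

record 'a mv_algebra = "'a partial_object" +
  mv_add  :: "'a \<Rightarrow> 'a \<Rightarrow> 'a" (infixl \<open>\<oplus>\<index>\<close> 65)
  mv_neg  :: "'a \<Rightarrow> 'a" (\<open>\<sim>\<index> _\<close> [81] 80)
  mv_zero :: "'a" (\<open>\<zero>\<index>\<close>)

locale mv_algebra =
  fixes A :: "('a, 'm) mv_algebra_scheme" (structure)
  assumes add_closed [simp, intro]: "\<lbrakk>x \<in> carrier A; y \<in> carrier A\<rbrakk> \<Longrightarrow> x \<oplus> y \<in> carrier A"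
    and neg_closed [simp, intro]: "x \<in> carrier A \<Longrightarrow> \<sim> x \<in> carrier A"
    and zero_closed [simp, intro]: "\<zero> \<in> carrier A"
    and add_assoc: "\<lbrakk>x \<in> carrier A; y \<in> carrier A; z \<in> carrier A\<rbrakk>
          \<Longrightarrow> (x \<oplus> y) \<oplus> z = x \<oplus> (y \<oplus> z)"
    and add_comm: "\<lbrakk>x \<in> carrier A; y \<in> carrier A\<rbrakk> \<Longrightarrow> x \<oplus> y = y \<oplus> x"
    and add_zero: "x \<in> carrier A \<Longrightarrow> x \<oplus> \<zero> = x"
    and neg_neg: "x \<in> carrier A \<Longrightarrow> \<sim> (\<sim> x) = x"
    and add_neg_zero: "x \<in> carrier A \<Longrightarrow> x \<oplus> \<sim> \<zero> = \<sim> \<zero>"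
    and mv_axiom: "\<lbrakk>x \<in> carrier A; y \<in> carrier A\<rbrakk>
          \<Longrightarrow> \<sim> (\<sim> x \<oplus> y) \<oplus> y = \<sim> (\<sim> y \<oplus> x) \<oplus> x"

definition mv_one :: "('a, 'm) mv_algebra_scheme \<Rightarrow> 'a" (\<open>\<one>\<index>\<close>) where
  "\<one>\<^bsub>A\<^esub> = \<sim>\<^bsub>A\<^esub> \<zero>\<^bsub>A\<^esub>"

definition mv_mult :: "('a, 'm) mv_algebra_scheme \<Rightarrow> 'a \<Rightarrow> 'a \<Rightarrow> 'a" (infixl \<open>\<odot>\<index>\<close> 70) where
  "x \<odot>\<^bsub>A\<^esub> y = \<sim>\<^bsub>A\<^esub> (\<sim>\<^bsub>A\<^esub> x \<oplus>\<^bsub>A\<^esub> \<sim>\<^bsub>A\<^esub> y)"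

definition mv_le :: "('a, 'm) mv_algebra_scheme \<Rightarrow> 'a \<Rightarrow> 'a \<Rightarrow> bool" (infix \<open>\<preceq>\<index>\<close> 50) where
  "x \<preceq>\<^bsub>A\<^esub> y \<longleftrightarrow> \<sim>\<^bsub>A\<^esub> x \<oplus>\<^bsub>A\<^esub> y = \<one>\<^bsub>A\<^esub>"

definition mv_dist :: "('a, 'm) mv_algebra_scheme \<Rightarrow> 'a \<Rightarrow> 'a \<Rightarrow> 'a" where
  "mv_dist A x y = (x \<odot>\<^bsub>A\<^esub> \<sim>\<^bsub>A\<^esub> y) \<oplus>\<^bsub>A\<^esub> (y \<odot>\<^bsub>A\<^esub> \<sim>\<^bsub>A\<^esub> x)"

locale mv_ideal = mv_algebra A for I :: "'a set" and A :: "('a, 'm) mv_algebra_scheme" (structure) +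
  assumes ideal_subset: "I \<subseteq> carrier A"
    and ideal_zero: "\<zero> \<in> I"
    and ideal_add: "\<lbrakk>a \<in> I; b \<in> I\<rbrakk> \<Longrightarrow> a \<oplus> b \<in> I"
    and ideal_down: "\<lbrakk>b \<in> I; a \<in> carrier A; a \<preceq> b\<rbrakk> \<Longrightarrow> a \<in> I"

locale proper_mv_ideal = mv_ideal +
  assumes ideal_proper: "I \<noteq> carrier A"

definition mv_cong :: "('a, 'm) mv_algebra_scheme \<Rightarrow> 'a set \<Rightarrow> 'a rel" where
  "mv_cong A I = {(x, y). x \<in> carrier A \<and> y \<in> carrier A \<and> mv_dist A x y \<in> I}"

text \<open>
  The operations on classes are given in the style of \<^theory>\<open>HOL.Equiv_Relations\<close>: when
  \<^term>\<open>mv_cong A I\<close> is a congruence, the unions below range over equal sets, so that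
  \<open>[x] \<oplus> [y] = [x \<oplus> y]\<close> and \<open>\<sim> [x] = [\<sim> x]\<close>.
\<close>
definition mv_quotient :: "('a, 'm) mv_algebra_scheme \<Rightarrow> 'a set \<Rightarrow> 'a set mv_algebra" where
  "mv_quotient A I =
    \<lparr> carrier = carrier A // mv_cong A I,
      mv_add = (\<lambda>X Y. \<Union>x\<in>X. \<Union>y\<in>Y. mv_cong A I `` {x \<oplus>\<^bsub>A\<^esub> y}),
      mv_neg = (\<lambda>X. \<Union>x\<in>X. mv_cong A I `` {\<sim>\<^bsub>A\<^esub> x}),
      mv_zero = mv_cong A I `` {\<zero>\<^bsub>A\<^esub>} \<rparr>"

section \<open>Zero-divisor graphs\<close>

text \<open>
  A simple graph is represented as a symmetric loop-free digraph without parallel arcs: each edge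
  is the pair of arcs \<open>(x, y)\<close> and \<open>(y, x)\<close>. The vertex set need not be finite.
\<close>
definition ideal_graph_verts :: "('a, 'm) mv_algebra_scheme \<Rightarrow> 'a set \<Rightarrow> 'a set" where
  "ideal_graph_verts A I = {x \<in> carrier A - I. \<exists>y \<in> carrier A - I. x \<odot>\<^bsub>A\<^esub> y \<in> I}"

definition ideal_graph :: "('a, 'm) mv_algebra_scheme \<Rightarrow> 'a set \<Rightarrow> 'a pair_pre_digraph" where
  "ideal_graph A I =
    \<lparr> pverts = ideal_graph_verts A I,
      parcs = {(x, y). x \<in> ideal_graph_verts A I \<and> y \<in> ideal_graph_verts A I \<and>
                       x \<noteq> y \<and> x \<odot>\<^bsub>A\<^esub> y \<in> I} \<rparr>"

definition zero_divisor_graph :: "('a, 'm) mv_algebra_scheme \<Rightarrow> 'a pair_pre_digraph" where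
  "zero_divisor_graph B = ideal_graph B {\<zero>\<^bsub>B\<^esub>}"

lemma (in mv_algebra) ideal_graph_simple: "pair_bidirected_digraph (ideal_graph A I)"
proof -
  have comm: "x \<odot> y = y \<odot> x" if "x \<in> carrier A" "y \<in> carrier A" for x y
    unfolding mv_mult_def using add_comm[OF neg_closed[OF that(1)] neg_closed[OF that(2)]] by simp
  have "sym (parcs (ideal_graph A I))"
  proof (rule symI)
    fix x y assume "(x, y) \<in> parcs (ideal_graph A I)"
    then show "(y, x) \<in> parcs (ideal_graph A I)"
      using comm[of x y] by (simp add: ideal_graph_def ideal_graph_verts_def) blast
  qed
  then have "symmetric (with_proj (ideal_graph A I))"
    by (simp add: symmetric_def)
  then show ?thesis
    by unfold_locales (auto simp: ideal_graph_def)
qed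

section \<open>Distance and diameter\<close>

text \<open>
  In \<^typ>\<open>enat\<close> the infimum of the empty set is \<open>\<infinity>\<close> and its supremum is \<open>0\<close>: vertices not
  joined by a path are at distance \<open>\<infinity>\<close>, and the graph without vertices has diameter \<open>0\<close>.
\<close>
definition graph_distance :: "('a, 'b) pre_digraph \<Rightarrow> 'a \<Rightarrow> 'a \<Rightarrow> enat" where
  "graph_distance G u v = (INF p \<in> {p. vpath p G \<and> hd p = u \<and> last p = v}. enat (vwalk_length p))"

definition graph_diameter :: "('a, 'b) pre_digraph \<Rightarrow> enat" where
  "graph_diameter G = (SUP (u, v) \<in> verts G \<times> verts G. graph_distance G u v)"

end

(*
  Two vertices x, y are at distance 3 iff x * y is outside I and no z outside I satisfies both
  x * z : I and y * z : I, where * denotes the MV-product; no distance exceeds 3, since from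
  neighbours x', y' of x, y one gets either the walk x - x' - y' - y or the common neighbour
  x' * y'. The only way the graph of I and that of A/I could differ is at distinct vertices in
  one class, but such x, y have a common annihilator outside I because x has one. Hence
  "diameter 3" is a first-order condition that only sees classes modulo I.
*)
theory Submission
  imports Defs
begin

section \<open>Distances through walks\<close>

lemma vwalk_to_vpath_length: "length (vwalk_to_vpath p) \<le> length p"
proof (induct p rule: vwalk_to_vpath_induct3)
  case (in_set x xs)
  then show ?case using length_dropWhile_le[of "\<lambda>y. y \<noteq> x" xs] by simp
qed auto

text \<open>Distances range over paths, but removing the loops of a walk keeps its ends and never
  lengthens it, so upper bounds may come from walks with repeated vertices.\<close>

lemma graph_distance_le_vwalk:
  assumes "vwalk p G" "hd p = u" "last p = v"
  shows "graph_distance G u v \<le> enat (vwalk_length p)"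
proof -
  let ?q = "vwalk_to_vpath p"
  have "graph_distance G u v \<le> enat (vwalk_length ?q)"
    unfolding graph_distance_def
    by (rule INF_lower)
      (use assms in \<open>simp add: vwalk_to_vpath_vpath vwalk_to_vpath_hd vwalk_to_vpath_last\<close>)
  also have "\<dots> \<le> enat (vwalk_length p)"
    using vwalk_to_vpath_length[of p] by simp
  finally show ?thesis .
qed

lemma graph_distance_refl:
  assumes "v \<in> verts G"
  shows "graph_distance G v v = 0"
proof -
  have "vwalk [v] G" using assms by (simp add: vwalk_def)
  from graph_distance_le_vwalk[OF this] show ?thesis by (simp add: zero_enat_def[symmetric])
qed

lemma graph_distance_step:
  assumes arc: "(u, v) \<in> arcs_ends G" and u: "u \<in> verts G"
  shows "graph_distance G u w \<le> eSuc (graph_distance G v w)"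
proof (cases "{p. vpath p G \<and> hd p = v \<and> last p = w} = {}")
  \<comment> \<open>With no path from \<open>v\<close> to \<open>w\<close> the right-hand side is
    \<infinity>.\<close>
  case True
  then show ?thesis by (simp only: graph_distance_def) (simp add: top_enat_def)
next
  case False
  let ?S = "(\<lambda>p. enat (vwalk_length p)) ` {p. vpath p G \<and> hd p = v \<and> last p = w}"
  from False obtain k where "k \<in> ?S" by blast
  \<comment> \<open>\<open>enat\<close> is well-ordered, so the infimum is attained by an actual
    path \<open>p\<close>.\<close>
  then have "Inf ?S \<in> ?S" by (rule wellorder_InfI)
  then obtain p where p: "vwalk p G" "hd p = v" "last p = w"
    and len: "graph_distance G v w = enat (vwalk_length p)"
    by (auto simp: graph_distance_def)
  then have ne: "p \<noteq> []" by auto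
  \<comment> \<open>\<open>p\<close> may already pass through \<open>u\<close>, so
    \<open>u # p\<close> is in general only a walk.\<close>
  have "vwalk (u # p) G" using p arc u by (intro vwalk_consI) auto
  then have "graph_distance G u w \<le> enat (vwalk_length (u # p))"
    by (rule graph_distance_le_vwalk) (use p ne in auto)
  also have "\<dots> = eSuc (graph_distance G v w)"
    using ne len by (simp add: eSuc_enat)
  finally show ?thesis .
qed

section \<open>Order and ideals\<close>

context mv_algebra
begin

lemma mult_closed [simp, intro]:
  "\<lbrakk>x \<in> carrier A; y \<in> carrier A\<rbrakk> \<Longrightarrow> x \<odot> y \<in> carrier A"
  by (simp add: mv_mult_def)

lemma mult_comm: "\<lbrakk>x \<in> carrier A; y \<in> carrier A\<rbrakk> \<Longrightarrow> x \<odot> y = y \<odot> x"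
  by (simp add: mv_mult_def add_comm)

lemma mult_assoc:
  "\<lbrakk>x \<in> carrier A; y \<in> carrier A; z \<in> carrier A\<rbrakk> \<Longrightarrow> (x \<odot> y) \<odot> z = x \<odot> (y \<odot> z)"
  by (simp add: mv_mult_def neg_neg add_assoc)

lemma zero_add: "x \<in> carrier A \<Longrightarrow> \<zero> \<oplus> x = x"
  using add_comm[of x \<zero>] add_zero by simp

lemma add_left_comm:
  "\<lbrakk>x \<in> carrier A; y \<in> carrier A; z \<in> carrier A\<rbrakk> \<Longrightarrow> x \<oplus> (y \<oplus> z) = y \<oplus> (x \<oplus> z)"
  by (metis add_assoc add_comm)

lemmas add_ac = add_assoc add_comm add_left_comm

text \<open>At y = 1 the two sides of \<open>mv_axiom\<close> reduce to 1 and
  \<open>\<sim> x \<oplus> x\<close>.\<close>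

lemma le_refl: "x \<in> carrier A \<Longrightarrow> x \<preceq> x"
  using mv_axiom[of x "\<sim> \<zero>"]
  by (simp add: mv_le_def mv_one_def add_neg_zero neg_neg zero_add)

lemma le_add: "\<lbrakk>x \<in> carrier A; y \<in> carrier A\<rbrakk> \<Longrightarrow> x \<preceq> x \<oplus> y"
  using le_refl[of x]
  by (simp add: mv_le_def mv_one_def flip: add_assoc)
    (simp add: add_neg_zero add_comm[of "\<sim> \<zero>"])

text \<open>The order is the natural order of the additive monoid; transitivity and monotonicity
  thereby become monoid arithmetic.\<close>

lemma le_iff_add:
  assumes "x \<in> carrier A" "y \<in> carrier A"
  shows "x \<preceq> y \<longleftrightarrow> (\<exists>z\<in>carrier A. y = x \<oplus> z)"
proof
  assume "x \<preceq> y"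
  \<comment> \<open>As \<open>\<sim> x \<oplus> y\<close> is 1, the left side of
    \<open>mv_axiom\<close> is just \<open>y\<close>; the right side supplies the witness, which is
    the difference of \<open>y\<close> and \<open>x\<close>.\<close>
  then have "y = x \<oplus> \<sim> (\<sim> y \<oplus> x)"
    using mv_axiom[OF assms] assms
    by (simp add: mv_le_def mv_one_def neg_neg zero_add add_zero add_comm)
  then show "\<exists>z\<in>carrier A. y = x \<oplus> z" using assms by blast
qed (use assms le_add in auto)

lemma le_trans:
  assumes "x \<preceq> y" "y \<preceq> z" "x \<in> carrier A" "y \<in> carrier A" "z \<in> carrier A"
  shows "x \<preceq> z"
proof -
  obtain u v where "u \<in> carrier A" "y = x \<oplus> u" "v \<in> carrier A" "z = y \<oplus> v"
    using assms by (auto simp: le_iff_add)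
  then have "z = x \<oplus> (u \<oplus> v)" "u \<oplus> v \<in> carrier A" using assms by (auto simp: add_assoc)
  then show ?thesis using assms le_add by blast
qed

lemma add_mono:
  assumes "x \<preceq> y" "u \<preceq> v" "x \<in> carrier A" "y \<in> carrier A" "u \<in> carrier A" "v \<in> carrier A"
  shows "x \<oplus> u \<preceq> y \<oplus> v"
proof -
  obtain a b where ab: "a \<in> carrier A" "y = x \<oplus> a" "b \<in> carrier A" "v = u \<oplus> b"
    using assms by (auto simp: le_iff_add)
  then have "y \<oplus> v = (x \<oplus> u) \<oplus> (a \<oplus> b)" using assms by (simp add: add_ac)
  then show ?thesis using assms ab le_add[of "x \<oplus> u" "a \<oplus> b"] by simp
qed

text \<open>Residuation: \<open>x \<odot> \<sim> y\<close> is the truncated difference of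
  \<open>x\<close> and \<open>y\<close>. Both inequalities unfold to
  \<open>\<sim> x \<oplus> y \<oplus> c = \<one>\<close>.\<close>

lemma diff_le_iff:
  "\<lbrakk>x \<in> carrier A; y \<in> carrier A; c \<in> carrier A\<rbrakk> \<Longrightarrow> x \<odot> \<sim> y \<preceq> c \<longleftrightarrow> x \<preceq> y \<oplus> c"
  by (simp add: mv_le_def mv_mult_def neg_neg add_assoc)

lemma le_add_diff: "\<lbrakk>x \<in> carrier A; y \<in> carrier A\<rbrakk> \<Longrightarrow> x \<preceq> y \<oplus> x \<odot> \<sim> y"
  using diff_le_iff[of x y "x \<odot> \<sim> y"] le_refl by simp

lemma diff_self: "x \<in> carrier A \<Longrightarrow> x \<odot> \<sim> x = \<zero>"
  using le_refl[of x] by (simp add: mv_mult_def mv_le_def mv_one_def neg_neg)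

text \<open>By residuation it suffices to bound \<open>x\<close> by \<open>z\<close> plus both
  differences, which follows by chaining two instances of \<open>le_add_diff\<close>. This yields
  transitivity of the congruence.\<close>

lemma diff_triangle:
  assumes "x \<in> carrier A" "y \<in> carrier A" "z \<in> carrier A"
  shows "x \<odot> \<sim> z \<preceq> x \<odot> \<sim> y \<oplus> y \<odot> \<sim> z"
proof -
  have "y \<oplus> x \<odot> \<sim> y \<preceq> (z \<oplus> y \<odot> \<sim> z) \<oplus> x \<odot> \<sim> y"
    using assms by (intro add_mono le_refl le_add_diff) auto
  then have "x \<preceq> (z \<oplus> y \<odot> \<sim> z) \<oplus> x \<odot> \<sim> y"
    using assms by (intro le_trans[OF le_add_diff[of x y]]) auto
  then show ?thesis using assms by (simp add: diff_le_iff add_ac)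
qed

text \<open>Add the two instances of \<open>le_add_diff\<close> and apply residuation. This yields
  compatibility of the congruence with addition.\<close>

lemma diff_add_le:
  assumes "x \<in> carrier A" "y \<in> carrier A" "u \<in> carrier A" "v \<in> carrier A"
  shows "(x \<oplus> u) \<odot> \<sim> (y \<oplus> v) \<preceq> x \<odot> \<sim> y \<oplus> u \<odot> \<sim> v"
proof -
  have "x \<oplus> u \<preceq> (y \<oplus> x \<odot> \<sim> y) \<oplus> (v \<oplus> u \<odot> \<sim> v)"
    using assms by (intro add_mono le_add_diff) auto
  then show ?thesis using assms by (simp add: diff_le_iff add_ac)
qed

text \<open>The product is the difference of \<open>x\<close> and \<open>\<sim> y\<close>, so
  residuation reduces the claim to \<open>le_add\<close>.\<close>

lemma mult_le_left: "\<lbrakk>x \<in> carrier A; y \<in> carrier A\<rbrakk> \<Longrightarrow> x \<odot> y \<preceq> x"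
  using le_add[of x "\<sim> y"] diff_le_iff[of x "\<sim> y" x] by (simp add: neg_neg add_comm)

text \<open>Makes every zero-divisor graph an instance of an ideal graph, so that results on the
  latter apply to the quotient.\<close>

lemma mv_ideal_zero: "mv_ideal {\<zero>} A"
proof unfold_locales
  fix a b assume "b \<in> {\<zero>}" "a \<in> carrier A" "a \<preceq> b"
  then have "\<sim> a = \<sim> \<zero>" by (simp add: mv_le_def mv_one_def add_zero)
  then show "a \<in> {\<zero>}" using neg_neg \<open>a \<in> carrier A\<close> by (metis singletonI zero_closed)
qed (auto simp: add_zero)

end

context mv_ideal
begin

lemma ideal_mult: "\<lbrakk>x \<in> I; y \<in> carrier A\<rbrakk> \<Longrightarrow> x \<odot> y \<in> I"
  using ideal_down[of x "x \<odot> y"] mult_le_left ideal_subset by auto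

text \<open>Each summand lies below the sum. This splits membership of \<open>mv_dist A x y\<close>
  in \<open>I\<close> into two one-sided conditions.\<close>

lemma ideal_add_iff:
  assumes "x \<in> carrier A" "y \<in> carrier A"
  shows "x \<oplus> y \<in> I \<longleftrightarrow> x \<in> I \<and> y \<in> I"
proof
  assume I: "x \<oplus> y \<in> I"
  have "x \<preceq> x \<oplus> y" using assms by (rule le_add)
  moreover have "y \<preceq> x \<oplus> y" using assms le_add[of y x] by (simp add: add_comm)
  ultimately show "x \<in> I \<and> y \<in> I" using I assms ideal_down by blast
qed (auto intro: ideal_add)

section \<open>The quotient algebra\<close>

lemma mv_cong_iff:
  "(x, y) \<in> mv_cong A I \<longleftrightarrow>
    x \<in> carrier A \<and> y \<in> carrier A \<and> x \<odot> \<sim> y \<in> I \<and> y \<odot> \<sim> x \<in> I"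
  by (auto simp: mv_cong_def mv_dist_def ideal_add_iff)

lemma equiv_mv_cong: "equiv (carrier A) (mv_cong A I)"
proof (rule equivI)
  show "mv_cong A I \<subseteq> carrier A \<times> carrier A" by (auto simp: mv_cong_iff)
  show "refl_on (carrier A) (mv_cong A I)"
    by (rule refl_onI) (auto simp: mv_cong_iff diff_self ideal_zero)
  show "sym (mv_cong A I)" by (rule symI) (auto simp: mv_cong_iff)
  have "x \<odot> \<sim> z \<in> I"
    if "x \<in> carrier A" "y \<in> carrier A" "z \<in> carrier A" "x \<odot> \<sim> y \<in> I" "y \<odot> \<sim> z \<in> I" for x y z
    using that diff_triangle[of x y z] by (meson ideal_add ideal_down mult_closed neg_closed)
  then show "trans (mv_cong A I)" by (intro transI) (auto simp: mv_cong_iff)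
qed

text \<open>Negation merely exchanges the two one-sided differences.\<close>

lemma mv_cong_neg:
  assumes "(x, y) \<in> mv_cong A I"
  shows "(\<sim> x, \<sim> y) \<in> mv_cong A I"
proof -
  have "x \<in> carrier A" "y \<in> carrier A" using assms by (auto simp: mv_cong_iff)
  then show ?thesis
    using assms mult_comm[of "\<sim> x" y] mult_comm[of "\<sim> y" x] by (auto simp: mv_cong_iff neg_neg)
qed

lemma mv_cong_add:
  assumes "(x, y) \<in> mv_cong A I" "(u, v) \<in> mv_cong A I"
  shows "(x \<oplus> u, y \<oplus> v) \<in> mv_cong A I"
proof -
  have "(a \<oplus> b) \<odot> \<sim> (c \<oplus> d) \<in> I"
    if "a \<in> carrier A" "b \<in> carrier A" "c \<in> carrier A" "d \<in> carrier A"
      "a \<odot> \<sim> c \<in> I" "b \<odot> \<sim> d \<in> I" for a b c d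
    using that diff_add_le[of a c b d]
    by (meson add_closed ideal_add ideal_down mult_closed neg_closed)
  then show ?thesis using assms by (auto simp: mv_cong_iff)
qed

abbreviation (input) coset where "coset x \<equiv> mv_cong A I `` {x}"

lemma coset_eq_iff:
  "\<lbrakk>x \<in> carrier A; y \<in> carrier A\<rbrakk> \<Longrightarrow> coset x = coset y \<longleftrightarrow> (x, y) \<in> mv_cong A I"
  by (rule eq_equiv_class_iff[OF equiv_mv_cong])

lemma quotient_carrier: "carrier (mv_quotient A I) = coset ` carrier A"
  by (auto simp: mv_quotient_def quotient_def)

lemma quotient_zero: "\<zero>\<^bsub>mv_quotient A I\<^esub> = coset \<zero>"
  by (simp add: mv_quotient_def)

lemma quotient_neg:
  assumes "x \<in> carrier A"
  shows "\<sim>\<^bsub>mv_quotient A I\<^esub> coset x = coset (\<sim> x)"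
proof -
  have "(\<lambda>x. coset (\<sim> x)) respects mv_cong A I"
    by (rule congruentI) (rule equiv_class_eq[OF equiv_mv_cong mv_cong_neg])
  from UN_equiv_class[OF equiv_mv_cong this assms] show ?thesis
    by (simp add: mv_quotient_def)
qed

lemma quotient_add:
  assumes "x \<in> carrier A" "y \<in> carrier A"
  shows "coset x \<oplus>\<^bsub>mv_quotient A I\<^esub> coset y = coset (x \<oplus> y)"
proof -
  have "congruent2 (mv_cong A I) (mv_cong A I) (\<lambda>x y. coset (x \<oplus> y))"
    by (rule congruent2I') (rule equiv_class_eq[OF equiv_mv_cong mv_cong_add])
  from UN_equiv_class2[OF equiv_mv_cong equiv_mv_cong this assms] show ?thesis
    by (simp add: mv_quotient_def)
qed

lemma quotient_mult:
  "\<lbrakk>x \<in> carrier A; y \<in> carrier A\<rbrakk> \<Longrightarrow>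
    coset x \<odot>\<^bsub>mv_quotient A I\<^esub> coset y = coset (x \<odot> y)"
  by (simp add: mv_mult_def quotient_neg quotient_add)

lemma mv_algebra_quotient: "mv_algebra (mv_quotient A I)"
proof unfold_locales
  let ?Q = "mv_quotient A I"
  fix X Y assume "X \<in> carrier ?Q" "Y \<in> carrier ?Q"
  then obtain x y where xy: "x \<in> carrier A" "X = coset x" "y \<in> carrier A" "Y = coset y"
    by (auto simp: quotient_carrier)
  show "X \<oplus>\<^bsub>?Q\<^esub> Y = Y \<oplus>\<^bsub>?Q\<^esub> X"
    using xy by (simp add: quotient_add add_comm[of x y])
  show "\<sim>\<^bsub>?Q\<^esub> (\<sim>\<^bsub>?Q\<^esub> X \<oplus>\<^bsub>?Q\<^esub> Y) \<oplus>\<^bsub>?Q\<^esub> Y = \<sim>\<^bsub>?Q\<^esub> (\<sim>\<^bsub>?Q\<^esub> Y \<oplus>\<^bsub>?Q\<^esub> X) \<oplus>\<^bsub>?Q\<^esub> X"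
    using xy by (simp add: quotient_add quotient_neg mv_axiom[of x y])
  fix Z assume "Z \<in> carrier ?Q"
  then obtain z where "z \<in> carrier A" "Z = coset z" by (auto simp: quotient_carrier)
  then show "(X \<oplus>\<^bsub>?Q\<^esub> Y) \<oplus>\<^bsub>?Q\<^esub> Z = X \<oplus>\<^bsub>?Q\<^esub> (Y \<oplus>\<^bsub>?Q\<^esub> Z)"
    using xy by (simp add: quotient_add add_assoc)
qed (auto simp: quotient_carrier quotient_zero quotient_neg quotient_add
  add_zero neg_neg add_neg_zero)

text \<open>The difference of \<open>x\<close> and 0 is \<open>x\<close> itself, and that of 0 and
  \<open>x\<close> lies below 0.\<close>

lemma coset_zero_iff: "x \<in> carrier A \<Longrightarrow> coset x = coset \<zero> \<longleftrightarrow> x \<in> I"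
  using ideal_mult[OF ideal_zero, of "\<sim> x"]
  by (simp add: coset_eq_iff mv_cong_iff) (simp add: mv_mult_def neg_neg add_zero)

section \<open>Diameter three as a first-order condition\<close>

text \<open>Both ends are automatically vertices, each being the annihilator that the other one
  requires.\<close>

lemma ideal_graph_adj_iff:
  "(x, y) \<in> parcs (ideal_graph A I) \<longleftrightarrow>
    x \<in> carrier A - I \<and> y \<in> carrier A - I \<and> x \<noteq> y \<and> x \<odot> y \<in> I"
  using mult_comm[of x y] by (auto simp: ideal_graph_def ideal_graph_verts_def)

lemma pverts_ideal_graph:
  "pverts (ideal_graph A I) =
    {x \<in> carrier A. x \<notin> I \<and> (\<exists>y\<in>carrier A. y \<notin> I \<and> x \<odot> y \<in> I)}"
  by (auto simp: ideal_graph_def ideal_graph_verts_def)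

section \<open>Upper bounds on distances\<close>

abbreviation (input) ideal_graph_dist where
  "ideal_graph_dist \<equiv> graph_distance (with_proj (ideal_graph A I))"

text \<open>If \<open>x = y\<close> there is no arc, but the inequality is trivial. The bounds built
  on it thus also cover coinciding vertices.\<close>

lemma ideal_graph_dist_step:
  assumes "x \<in> carrier A - I" "y \<in> carrier A - I" "x \<odot> y \<in> I"
  shows "ideal_graph_dist x w \<le> eSuc (ideal_graph_dist y w)"
proof (cases "x = y")
  case True
  then show ?thesis by (simp add: ile_eSuc)
next
  case False
  then show ?thesis
    using assms
    by (intro graph_distance_step) (auto simp: ideal_graph_adj_iff pverts_ideal_graph)
qed

lemma ideal_graph_dist_le_1:
  assumes "x \<in> carrier A - I" "y \<in> carrier A - I" "x \<odot> y \<in> I"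
  shows "ideal_graph_dist x y \<le> 1"
proof -
  have "y \<in> pverts (ideal_graph A I)"
    using assms mult_comm[of x y] by (auto simp: pverts_ideal_graph)
  then have "ideal_graph_dist y y = 0" by (simp add: graph_distance_refl)
  then show ?thesis using ideal_graph_dist_step[OF assms, of y] by (simp add: one_eSuc)
qed

lemma ideal_graph_dist_le_2:
  assumes "x \<in> carrier A - I" "y \<in> carrier A - I" "z \<in> carrier A - I" "x \<odot> z \<in> I" "y \<odot> z \<in> I"
  shows "ideal_graph_dist x y \<le> 2"
proof -
  have "z \<odot> y \<in> I" using assms mult_comm[of y z] by auto
  then have "ideal_graph_dist z y \<le> 1" using assms by (intro ideal_graph_dist_le_1)
  then have "eSuc (ideal_graph_dist z y) \<le> eSuc 1" by simp
  moreover have "ideal_graph_dist x y \<le> eSuc (ideal_graph_dist z y)"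
    using assms by (intro ideal_graph_dist_step)
  ultimately show ?thesis
    by (metis eSuc_plus_1 one_add_one order_trans)
qed

lemma ideal_graph_dist_le_3:
  assumes x: "x \<in> pverts (ideal_graph A I)" and y: "y \<in> pverts (ideal_graph A I)"
  shows "ideal_graph_dist x y \<le> 3"
proof -
  obtain x' y' where x': "x' \<in> carrier A - I" "x \<odot> x' \<in> I" and y': "y' \<in> carrier A - I" "y \<odot> y' \<in> I"
    using x y by (auto simp: pverts_ideal_graph)
  have xy: "x \<in> carrier A - I" "y \<in> carrier A - I"
    using x y by (auto simp: pverts_ideal_graph)
  show ?thesis
  proof (cases "x' \<odot> y' \<in> I")
    case True
    \<comment> \<open>\<open>y'\<close> annihilates both \<open>x'\<close> and \<open>y\<close>
      modulo \<open>I\<close>; prepending \<open>x\<close> costs one more step.\<close>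
    then have "ideal_graph_dist x' y \<le> 2"
      using ideal_graph_dist_le_2[of x' y y'] x' y' xy by blast
    then have "eSuc (ideal_graph_dist x' y) \<le> eSuc 2" by (simp only: eSuc_ile_mono)
    moreover have "ideal_graph_dist x y \<le> eSuc (ideal_graph_dist x' y)"
      using x' xy by (intro ideal_graph_dist_step)
    moreover have "eSuc 2 = (3 :: enat)" by (simp add: eSuc_numeral)
    ultimately show ?thesis by (metis order_trans)
  next
    case False
    have "x \<odot> (x' \<odot> y') \<in> I"
      using x' y' xy ideal_mult[of "x \<odot> x'" y'] by (simp add: mult_assoc)
    moreover have "y \<odot> (x' \<odot> y') \<in> I"
      using x' y' xy ideal_mult[of "y \<odot> y'" x'] by (simp add: mult_assoc mult_comm[of x' y'])
    ultimately have "ideal_graph_dist x y \<le> 2"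
      using False x' y' xy by (intro ideal_graph_dist_le_2[of x y "x' \<odot> y'"]) auto
    also have "(2 :: enat) \<le> 3" by simp
    finally show ?thesis .
  qed
qed

section \<open>Lower bound and the criterion for diameter 3\<close>

lemma ideal_graph_dist_ge_3:
  assumes x: "x \<in> pverts (ideal_graph A I)" and "x \<odot> y \<notin> I"
    and z: "\<And>z. \<lbrakk>z \<in> carrier A; x \<odot> z \<in> I; y \<odot> z \<in> I\<rbrakk> \<Longrightarrow> z \<in> I"
  shows "3 \<le> ideal_graph_dist x y"
  unfolding graph_distance_def
proof (rule INF_greatest)
  fix p assume "p \<in> {p. vpath p (with_proj (ideal_graph A I)) \<and> hd p = x \<and> last p = y}"
  then have p: "vwalk p (with_proj (ideal_graph A I))" "hd p = x" "last p = y" by auto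
  \<comment> \<open>Otherwise an annihilator of \<open>x\<close> outside \<open>I\<close>, which
    exists for a vertex, would contradict \<open>z\<close>.\<close>
  have "x \<noteq> y" using x z by (auto simp: pverts_ideal_graph)
  \<comment> \<open>\<open>length\<close> counts vertices, one more than the edges. One vertex
    forces \<open>x = y\<close>, two force \<open>x \<odot> y \<in> I\<close>, and with three the
    middle one is a common annihilator outside \<open>I\<close>.\<close>
  have "\<not> length p < 4"
  proof
    assume "length p < 4"
    then consider "p = []" | a where "p = [a]" | a b where "p = [a, b]" | a b c where "p = [a, b, c]"
      by (auto simp: less_Suc_eq numeral_eq_Suc length_Suc_conv)
    then show False
    proof cases
      case (4 a b c)
      then have "(x, b) \<in> parcs (ideal_graph A I)" "(b, y) \<in> parcs (ideal_graph A I)"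
        using p by (auto simp: vwalk_def)
      then show False using z[of b] mult_comm[of b y] by (auto simp: ideal_graph_adj_iff)
    qed (use p assms(2) \<open>x \<noteq> y\<close> in \<open>auto simp: vwalk_def ideal_graph_adj_iff\<close>)
  qed
  then have "3 \<le> vwalk_length p" by simp
  then show "3 \<le> enat (vwalk_length p)" by (metis enat_ord_simps(1) numeral_eq_enat)
qed

lemma ideal_graph_diameter_3_iff:
  "graph_diameter (with_proj (ideal_graph A I)) = 3 \<longleftrightarrow>
    (\<exists>x\<in>pverts (ideal_graph A I). \<exists>y\<in>pverts (ideal_graph A I).
      x \<odot> y \<notin> I \<and> (\<forall>z\<in>carrier A. x \<odot> z \<in> I \<longrightarrow> y \<odot> z \<in> I \<longrightarrow> z \<in> I))"
    (is "?D = 3 \<longleftrightarrow> ?P")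
proof
  assume D: "?D = 3"
  show ?P
  proof (rule ccontr)
    assume nP: "\<not> ?P"
    have "ideal_graph_dist x y \<le> 2"
      if "x \<in> pverts (ideal_graph A I)" "y \<in> pverts (ideal_graph A I)" for x y
    proof (cases "x \<odot> y \<in> I")
      case True
      then have "ideal_graph_dist x y \<le> 1"
        using that by (intro ideal_graph_dist_le_1) (auto simp: pverts_ideal_graph)
      also have "(1 :: enat) \<le> 2" by simp
      finally show ?thesis .
    next
      case False
      have xy: "x \<in> carrier A - I" "y \<in> carrier A - I"
        using that by (auto simp: pverts_ideal_graph)
      from nP that False have "\<not> (\<forall>z\<in>carrier A. x \<odot> z \<in> I \<longrightarrow> y \<odot> z \<in> I \<longrightarrow> z \<in> I)"
        by blast
      then obtain z where "z \<in> carrier A - I" "x \<odot> z \<in> I" "y \<odot> z \<in> I" by blast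
      then show ?thesis by (rule ideal_graph_dist_le_2[OF xy])
    qed
    \<comment> \<open>The bound on the supremum also covers a graph without vertices.\<close>
    then have "?D \<le> 2" by (auto simp: graph_diameter_def intro!: SUP_least)
    then show False using D by simp
  qed
next
  assume ?P
  then obtain x y where x: "x \<in> pverts (ideal_graph A I)" and y: "y \<in> pverts (ideal_graph A I)"
    and "x \<odot> y \<notin> I" "\<And>z. \<lbrakk>z \<in> carrier A; x \<odot> z \<in> I; y \<odot> z \<in> I\<rbrakk> \<Longrightarrow> z \<in> I"
    by blast
  then have "3 \<le> ideal_graph_dist x y" by (intro ideal_graph_dist_ge_3)
  also have "\<dots> \<le> ?D"
    unfolding graph_diameter_def by (rule SUP_upper2[of "(x, y)"]) (use x y in auto)
  finally have "3 \<le> ?D" .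
  moreover have "?D \<le> 3"
    by (auto simp: graph_diameter_def intro!: SUP_least ideal_graph_dist_le_3)
  ultimately show "?D = 3" by (rule antisym[rotated])
qed

text \<open>The criterion mentions only products and membership in the ideal, never equality of
  vertices, so it can be read on classes or on representatives alike.\<close>

lemma diameter_3_iff_quotient:
  "graph_diameter (with_proj (ideal_graph A I)) = 3 \<longleftrightarrow>
    graph_diameter (with_proj (zero_divisor_graph (mv_quotient A I))) = 3"
proof -
  interpret Q: mv_ideal "{\<zero>\<^bsub>mv_quotient A I\<^esub>}" "mv_quotient A I"
    by (rule mv_algebra.mv_ideal_zero[OF mv_algebra_quotient])
  let ?V = "pverts (ideal_graph A I)" and ?Q = "mv_quotient A I"
  \<comment> \<open>A product of classes is zero iff the product of representatives lies in
    \<open>I\<close>; hence the vertices of the quotient graph are exactly the classes of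
    vertices.\<close>
  have V: "pverts (ideal_graph ?Q {\<zero>\<^bsub>?Q\<^esub>}) = coset ` ?V"
    unfolding pverts_ideal_graph Q.pverts_ideal_graph
    by (simp add: Compr_image_eq quotient_carrier quotient_zero quotient_mult coset_zero_iff
      cong: conj_cong bex_cong)
  \<comment> \<open>The rewrite rules for cosets are conditional on membership in the carrier; the
    congruence rules below provide it under the quantifiers.\<close>
  have carrier: "x \<in> carrier A" if "x \<in> ?V" for x
    using that by (simp add: pverts_ideal_graph)
  show ?thesis
    unfolding zero_divisor_graph_def ideal_graph_diameter_3_iff Q.ideal_graph_diameter_3_iff V
    by (simp add: carrier quotient_carrier quotient_zero quotient_mult coset_zero_iff
      cong: bex_cong ball_cong)
qed

end

theorem theorem4p16:
  fixes A :: "('a, 'm) mv_algebra_scheme" and I :: "'a set"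
  assumes "mv_algebra A" and "proper_mv_ideal I A"
  shows "graph_diameter (with_proj (ideal_graph A I)) = 3 \<longleftrightarrow>
         graph_diameter (with_proj (zero_divisor_graph (mv_quotient A I))) = 3"
  using mv_ideal.diameter_3_iff_quotient[OF proper_mv_ideal.axioms(1)[OF assms(2)]] .

end
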